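(* If $c:[\mathbb{N}]^2\to\{\text{BLUE},\text{RED}\}$ is any $2$-coloring, then $c$ has a path decomposition that is $\Delta^c_2$, i.e. computable from the Turing jump $c'$. In particular, if $c$ is computable then it has a path decomposition computable from the halting set $K$.
   Context: A (monochromatic) path of color $k$ for $c$ is a finite or infinite list $a_0,a_1,\dots$ of distinct natural numbers with $c(\{a_{i-1},a_i\})=k$ for all $i\ge1$; the empty list and one-element lists count as paths of every color. A path decomposition for a $2$-coloring $c$ is a pair consisting of a BLUE path and a RED path such that every natural number appears on exactly one of the two paths. Paths are identified with functions from an initial segment of $\mathbb{N}$ to $\mathbb{N}$ listing their elements in order. *)

theory Defs
  imports Main "HOL-Library.Nat_Bijection"
begin

datatype color = BLUE | RED

text \<open>A coloring of the two-element subsets of the natural numbers is a function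
  \<open>c :: nat set \<Rightarrow> color\<close>; nothing below depends on its values at sets that do not have
  exactly two elements.

  A finite or infinite list is a partial function \<open>f\<close> whose domain is an initial segment of
  the natural numbers; \<open>f i = Some a\<close> says that \<open>a\<close> is its entry at position \<open>i\<close>.\<close>

definition initial_segment :: "nat set \<Rightarrow> bool" where
  "initial_segment I \<longleftrightarrow> (\<forall>j\<in>I. \<forall>i<j. i \<in> I)"

definition mono_path :: "(nat set \<Rightarrow> color) \<Rightarrow> color \<Rightarrow> (nat \<rightharpoonup> nat) \<Rightarrow> bool" where
  "mono_path c k f \<longleftrightarrow>
     initial_segment (dom f) \<and> inj_on f (dom f) \<and>
     (\<forall>i a b. f i = Some a \<longrightarrow> f (Suc i) = Some b \<longrightarrow> c {a, b} = k)"

definition path_decomposition ::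
    "(nat set \<Rightarrow> color) \<Rightarrow> (nat \<rightharpoonup> nat) \<times> (nat \<rightharpoonup> nat) \<Rightarrow> bool" where
  "path_decomposition c P \<longleftrightarrow>
     (case P of (B, R) \<Rightarrow>
        mono_path c BLUE B \<and> mono_path c RED R \<and>
        (\<forall>n. (n \<in> ran B) \<noteq> (n \<in> ran R)))"


text \<open>Relative computability is given by Kleene's schemes for the functions partial recursive
  in a total oracle \<open>A\<close>.  All functions are unary; several arguments are passed through the
  Cantor pairing \<^const>\<open>prod_encode\<close>.\<close>

datatype prog =
    Zero
  | Succ
  | Proj1
  | Proj2
  | Query
  | Tuple prog prog
  | Comp prog prog
  | PrimRec prog prog
  | Mu prog

text \<open>In the last two schemes the input is a pair \<open>(a, n)\<close>, respectively a parameter \<open>a\<close>: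
  \<open>PrimRec p q\<close> computes \<open>h\<close> with \<open>h (a, 0) = p a\<close> and
  \<open>h (a, Suc m) = q (a, (m, h (a, m)))\<close>; \<open>Mu p\<close> returns the least \<open>n\<close> with \<open>p (a, n) = 0\<close>
  provided that \<open>p (a, m)\<close> is defined for all \<open>m < n\<close>, and is undefined if there is none.\<close>

primrec run :: "(nat \<Rightarrow> nat) \<Rightarrow> prog \<Rightarrow> nat \<rightharpoonup> nat" where
  "run A Zero = (\<lambda>x. Some 0)"
| "run A Succ = (\<lambda>x. Some (Suc x))"
| "run A Proj1 = (\<lambda>x. Some (fst (prod_decode x)))"
| "run A Proj2 = (\<lambda>x. Some (snd (prod_decode x)))"
| "run A Query = (\<lambda>x. Some (A x))"
| "run A (Tuple p q) =
     (\<lambda>x. Option.bind (run A p x) (\<lambda>y. Option.bind (run A q x) (\<lambda>z. Some (prod_encode (y, z)))))"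
| "run A (Comp p q) = (\<lambda>x. Option.bind (run A q x) (run A p))"
| "run A (PrimRec p q) =
     (\<lambda>x. case prod_decode x of (a, n) \<Rightarrow>
        rec_nat (run A p a)
          (\<lambda>m r. Option.bind r (\<lambda>v. run A q (prod_encode (a, prod_encode (m, v))))) n)"
| "run A (Mu p) =
     (\<lambda>a. let halts_at = (\<lambda>n. run A p (prod_encode (a, n)) = Some 0 \<and>
                           (\<forall>m<n. run A p (prod_encode (a, m)) \<noteq> None))
          in if \<exists>n. halts_at n then Some (LEAST n. halts_at n) else None)"

definition partial_computable_in :: "(nat \<Rightarrow> nat) \<Rightarrow> (nat \<rightharpoonup> nat) \<Rightarrow> bool" where
  "partial_computable_in A f \<longleftrightarrow> (\<exists>p. run A p = f)"

text \<open>Without an oracle: the constant zero oracle adds nothing, as its queries can be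
  replaced by \<^const>\<open>Zero\<close>.\<close>

definition no_oracle :: "nat \<Rightarrow> nat" where
  "no_oracle = (\<lambda>_. 0)"

definition computable :: "(nat \<Rightarrow> nat) \<Rightarrow> bool" where
  "computable f \<longleftrightarrow> partial_computable_in no_oracle (\<lambda>n. Some (f n))"

definition char_fun :: "nat set \<Rightarrow> nat \<Rightarrow> nat" where
  "char_fun S n = (if n \<in> S then 1 else 0)"

text \<open>An effective Goedel numbering of the programs, proved below to be a bijection.\<close>

primrec code :: "prog \<Rightarrow> nat" where
  "code Zero = 0"
| "code Succ = 1"
| "code Proj1 = 2"
| "code Proj2 = 3"
| "code Query = 4"
| "code (Tuple p q) = 5 + 4 * prod_encode (code p, code q)"
| "code (Comp p q) = 6 + 4 * prod_encode (code p, code q)"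
| "code (PrimRec p q) = 7 + 4 * prod_encode (code p, code q)"
| "code (Mu p) = 8 + 4 * code p"

lemma code_inject: "code p = code q \<longleftrightarrow> p = q"
proof
  show "code p = code q \<Longrightarrow> p = q"
  proof (induction p arbitrary: q)
    case (Tuple p1 p2)
    then show ?case by (cases q) (auto, presburger+)
  next
    case (Comp p1 p2)
    then show ?case by (cases q) (auto, presburger+)
  next
    case (PrimRec p1 p2)
    then show ?case by (cases q) (auto, presburger+)
  next
    case (Mu p)
    then show ?case by (cases q) (auto, presburger+)
  qed (case_tac q; auto)+
qed simp

lemma code_surj: "\<exists>p. code p = n"
proof (induction n rule: less_induct)
  case (less n)
  show ?case
  proof (cases "n < 5")
    case True
    then have "n = 0 \<or> n = 1 \<or> n = 2 \<or> n = 3 \<or> n = 4" by auto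
    then show ?thesis
      using code.simps(1-5) by metis
  next
    case False
    define k where "k = (n - 5) div 4"
    obtain a b where ab: "k = prod_encode (a, b)"
      by (metis prod_decode_inverse surj_pair)
    have "k < n"
      using False by (simp add: k_def)
    moreover have "a \<le> k" "b \<le> k"
      unfolding ab by (rule le_prod_encode_1, rule le_prod_encode_2)
    ultimately
    obtain p q r where pqr: "code p = a" "code q = b" "code r = k"
      by (meson less le_less_trans)
    have "n = 5 + 4 * k \<or> n = 6 + 4 * k \<or> n = 7 + 4 * k \<or> n = 8 + 4 * k"
      using False unfolding k_def by presburger
    then show ?thesis
      using code.simps(6-9) pqr ab by metis
  qed
qed

lemma bij_code: "bij code"
  by (metis bijI' code_inject code_surj)

definition jump :: "(nat \<Rightarrow> nat) \<Rightarrow> nat set" where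
  "jump A = {code p | p. run A p (code p) \<noteq> None}"

definition halting_set :: "nat set" where
  "halting_set = jump no_oracle"

definition color_fun :: "(nat set \<Rightarrow> color) \<Rightarrow> nat \<Rightarrow> nat" where
  "color_fun c n =
     (case prod_decode n of (a, b) \<Rightarrow> if a \<noteq> b \<and> c {a, b} = RED then 1 else 0)"

text \<open>The domain of a path is an initial segment, hence decidable, so a path is computable
  from a set exactly if it is partial computable in that set.\<close>

definition decomposition_computable_from ::
    "nat set \<Rightarrow> (nat \<rightharpoonup> nat) \<times> (nat \<rightharpoonup> nat) \<Rightarrow> bool" where
  "decomposition_computable_from S P \<longleftrightarrow>
     partial_computable_in (char_fun S) (fst P) \<and> partial_computable_in (char_fun S) (snd P)"

end

theory Submission
  imports Defs "HOL-Library.Sublist"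
begin

text \<open>Call a vertex \<open>v\<close> limit colored \<open>k\<close> if almost all edges at \<open>v\<close> have color \<open>k\<close>. A vertex that is
  not limit colored with the opposite color has arbitrarily late neighbours of color \<open>k\<close>, hence
  also common ones with any vertex that is limit colored \<open>k\<close>.

  If infinitely many vertices are limit colored \<open>k\<close>, keep the end of the path of color \<open>k\<close> among
  them: every vertex that is not limit colored with the opposite color can then be absorbed by that
  path. If only finitely many are, put all of them on the paths at the start. If both colors have
  only finitely many, start with all of them on the paths, but not at the ends. Then the blue end
  \<open>b\<close> has a fresh blue neighbour \<open>y\<close>, the red end \<open>r\<close> a fresh red neighbour \<open>z\<close>, and a new
  vertex \<open>x\<close> always extends a path: if \<open>x\<close> cannot be reached directly, nor over \<open>y\<close> from \<open>b\<close> nor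
  over \<open>z\<close> from \<open>r\<close>, then \<open>{x, y}\<close> is red and \<open>{x, z}\<close> is blue, and the color of \<open>{y, z}\<close> makes
  \<open>b, y, z, x\<close> a blue or \<open>r, z, y, x\<close> a red path.

  Paths are therefore only ever extended, and the next extension is found by unbounded search. The
  only part of the search condition not decidable in the coloring is that all edges from an end to
  vertices above a given bound have one color, which the jump decides.\<close>

subsection \<open>Closure properties of computable functions and decidable predicates\<close>

abbreviation pfst :: "nat \<Rightarrow> nat" where "pfst z \<equiv> fst (prod_decode z)"
abbreviation psnd :: "nat \<Rightarrow> nat" where "psnd z \<equiv> snd (prod_decode z)"

definition total_computable :: "(nat \<Rightarrow> nat) \<Rightarrow> (nat \<Rightarrow> nat) \<Rightarrow> bool" where
  "total_computable A f \<longleftrightarrow> partial_computable_in A (\<lambda>x. Some (f x))"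

text \<open>Truth is coded by 0, the value that \<open>Mu\<close> looks for, so that a decidable
  predicate can be searched directly.\<close>

definition decidable :: "(nat \<Rightarrow> nat) \<Rightarrow> (nat \<Rightarrow> bool) \<Rightarrow> bool" where
  "decidable A P \<longleftrightarrow> total_computable A (\<lambda>x. if P x then 0 else 1)"

lemma total_computableI: "(\<And>x. run A p x = Some (f x)) \<Longrightarrow> total_computable A f"
  unfolding total_computable_def partial_computable_in_def by blast

lemma total_computable_iff: "total_computable A f \<longleftrightarrow> (\<exists>p. \<forall>x. run A p x = Some (f x))"
  unfolding total_computable_def partial_computable_in_def by (simp add: fun_eq_iff)

named_theorems comp_intros

lemma total_computable_comp:
  assumes "total_computable A f" "total_computable A g"
  shows "total_computable A (\<lambda>x. f (g x))"
proof -
  obtain p where "\<And>x. run A p x = Some (f x)"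
    using assms(1) unfolding total_computable_iff by blast
  moreover obtain q where "\<And>x. run A q x = Some (g x)"
    using assms(2) unfolding total_computable_iff by blast
  ultimately show ?thesis by (intro total_computableI[where p = "Comp p q"]) auto
qed

lemma total_computable_pair [comp_intros]:
  assumes "total_computable A f" "total_computable A g"
  shows "total_computable A (\<lambda>x. prod_encode (f x, g x))"
proof -
  obtain p where "\<And>x. run A p x = Some (f x)"
    using assms(1) unfolding total_computable_iff by blast
  moreover obtain q where "\<And>x. run A q x = Some (g x)"
    using assms(2) unfolding total_computable_iff by blast
  ultimately show ?thesis by (intro total_computableI[where p = "Tuple p q"]) auto
qed

lemma total_computable_id [comp_intros]: "total_computable A (\<lambda>x. x)"
  \<comment> \<open>No scheme is the identity, but pairing the two projections of the input gives it
    back.\<close>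
  by (rule total_computableI[where p = "Tuple Proj1 Proj2"]) auto

lemma total_computable_Suc [comp_intros]:
  "total_computable A f \<Longrightarrow> total_computable A (\<lambda>x. Suc (f x))"
  by (rule total_computable_comp[where f = "\<lambda>x. Suc x"]) (rule total_computableI[where p = Succ], auto)

lemma total_computable_pfst [comp_intros]:
  "total_computable A f \<Longrightarrow> total_computable A (\<lambda>x. pfst (f x))"
  by (rule total_computable_comp[where f = "\<lambda>x. pfst x"]) (rule total_computableI[where p = Proj1], auto)

lemma total_computable_psnd [comp_intros]:
  "total_computable A f \<Longrightarrow> total_computable A (\<lambda>x. psnd (f x))"
  by (rule total_computable_comp[where f = "\<lambda>x. psnd x"]) (rule total_computableI[where p = Proj2], auto)

lemma total_computable_oracle:
  "total_computable A f \<Longrightarrow> total_computable A (\<lambda>x. A (f x))"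
  by (rule total_computable_comp[where f = "\<lambda>x. A x"]) (rule total_computableI[where p = Query], auto)

lemma total_computable_const [comp_intros]: "total_computable A (\<lambda>x. k)"
proof (induction k)
  case 0
  show ?case by (rule total_computableI[where p = Zero]) auto
qed (rule total_computable_Suc)

text \<open>Only the values of \<open>q\<close> along \<open>h\<close> matter, so \<open>q\<close>
  may be partial; this admits a recursion whose step is an unbounded search.\<close>

lemma run_PrimRec_total:
  assumes "run A p a = Some (h 0)"
    and "\<And>m. m < n \<Longrightarrow> run A q (prod_encode (a, prod_encode (m, h m))) = Some (h (Suc m))"
  shows "run A (PrimRec p q) (prod_encode (a, n)) = Some (h n)"
  using assms(2) by (induction n) (auto simp: assms(1))

lemma total_computable_rec_nat:
  assumes f: "total_computable A f" and n: "total_computable A n"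
    and g: "total_computable A (\<lambda>z. g (pfst z) (pfst (psnd z)) (psnd (psnd z)))"
  shows "total_computable A (\<lambda>x. rec_nat (f x) (g x) (n x))"
proof -
  obtain p where p: "\<And>x. run A p x = Some (f x)"
    using f unfolding total_computable_iff by blast
  obtain q where q: "\<And>z. run A q z = Some (g (pfst z) (pfst (psnd z)) (psnd (psnd z)))"
    using g unfolding total_computable_iff by blast
  obtain r where r: "\<And>x. run A r x = Some (n x)"
    using n unfolding total_computable_iff by blast
  show ?thesis
  proof (rule total_computableI)
    fix x
    have "run A (PrimRec p q) (prod_encode (x, n x)) = Some (rec_nat (f x) (g x) (n x))"
      by (rule run_PrimRec_total) (auto simp: p q)
    then show "run A (Comp (PrimRec p q) (Tuple (Tuple Proj1 Proj2) r)) x =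
        Some (rec_nat (f x) (g x) (n x))"
      by (simp add: r)
  qed
qed

section \<open>Arithmetic and bounded sums\<close>

lemma total_computable_add [comp_intros]:
  assumes "total_computable A f" "total_computable A g"
  shows "total_computable A (\<lambda>x. f x + g x)"
proof -
  have "f x + g x = rec_nat (f x) (\<lambda>m v. Suc v) (g x)" for x
    by (induction "g x" arbitrary: g) (auto, metis add_Suc_right nat.rec(2))
  moreover have "total_computable A (\<lambda>x. rec_nat (f x) (\<lambda>m v. Suc v) (g x))"
    by (rule total_computable_rec_nat) (intro assms comp_intros)+
  ultimately show ?thesis by simp
qed

lemma total_computable_pred:
  assumes "total_computable A f"
  shows "total_computable A (\<lambda>x. f x - 1)"
proof -
  have "n - 1 = rec_nat 0 (\<lambda>m v. m) n" for n :: nat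
    by (cases n) auto
  moreover have "total_computable A (\<lambda>x. rec_nat 0 (\<lambda>m v. m) (f x))"
    by (rule total_computable_rec_nat) (intro assms comp_intros)+
  ultimately show ?thesis by simp
qed

lemma total_computable_diff [comp_intros]:
  assumes "total_computable A f" "total_computable A g"
  shows "total_computable A (\<lambda>x. f x - g x)"
proof -
  have "rec_nat a (\<lambda>m v. v - 1) b = a - b" for a b :: nat
    by (induction b) auto
  moreover have "total_computable A (\<lambda>x. rec_nat (f x) (\<lambda>m v. v - 1) (g x))"
    by (rule total_computable_rec_nat) (intro assms total_computable_pred comp_intros)+
  ultimately show ?thesis by simp
qed

lemma total_computable_sum:
  assumes "total_computable A n" "total_computable A (\<lambda>z. g (pfst z) (psnd z))"
  shows "total_computable A (\<lambda>x. \<Sum>i<n x. g x i)"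
proof -
  have "(\<Sum>i<k. g x i) = rec_nat 0 (\<lambda>m v. v + g x m) k" for k x
    by (induction k) auto
  moreover have "total_computable A (\<lambda>z. g (pfst z) (pfst (psnd z)))"
    using total_computable_comp[OF assms(2),
        of "\<lambda>z. prod_encode (pfst z, pfst (psnd z))"]
    by (simp add: comp_intros)
  then have "total_computable A (\<lambda>x. rec_nat 0 (\<lambda>m v. v + g x m) (n x))"
    by (intro total_computable_rec_nat assms comp_intros)
  ultimately show ?thesis by simp
qed

section \<open>Decidable predicates and bounded quantifiers\<close>

lemma decidable_eq_0:
  assumes "total_computable A f"
  shows "decidable A (\<lambda>x. f x = 0)"
proof -
  \<comment> \<open>Truncated subtraction from 1, applied twice, keeps 0 and sends every positive
    value to 1.\<close>
  have "(if f x = 0 then 0 else 1) = 1 - (1 - f x)" for x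
    by auto
  then show ?thesis
    unfolding decidable_def by (simp only:) (intro assms comp_intros)
qed

lemma decidable_comp:
  "decidable A P \<Longrightarrow> total_computable A f \<Longrightarrow> decidable A (\<lambda>x. P (f x))"
  unfolding decidable_def by (rule total_computable_comp)

lemma decidable_const [comp_intros]: "decidable A (\<lambda>x. b)"
  unfolding decidable_def by (rule total_computable_const)

lemma decidable_not [comp_intros]:
  assumes "decidable A P"
  shows "decidable A (\<lambda>x. \<not> P x)"
proof -
  have "(\<not> P x) = (1 - (if P x then 0 else 1) = (0::nat))" for x
    by simp
  then show ?thesis
    using assms unfolding decidable_def[of A P]
    by (simp only:) (intro decidable_eq_0 comp_intros)
qed

lemma decidable_conj [comp_intros]:
  assumes "decidable A P" "decidable A Q"
  shows "decidable A (\<lambda>x. P x \<and> Q x)"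
proof -
  have "(P x \<and> Q x) = ((if P x then 0 else 1) + (if Q x then 0 else 1) = (0::nat))" for x
    by simp
  then show ?thesis
    using assms unfolding decidable_def[of A P] decidable_def[of A Q]
    by (simp only:) (intro decidable_eq_0 comp_intros)
qed

lemma decidable_disj [comp_intros]:
  assumes "decidable A P" "decidable A Q"
  shows "decidable A (\<lambda>x. P x \<or> Q x)"
proof -
  have "decidable A (\<lambda>x. \<not> (\<not> P x \<and> \<not> Q x))"
    by (intro assms decidable_not decidable_conj)
  then show ?thesis by simp
qed

lemma decidable_imp [comp_intros]:
  assumes "decidable A P" "decidable A Q"
  shows "decidable A (\<lambda>x. P x \<longrightarrow> Q x)"
proof -
  have "decidable A (\<lambda>x. \<not> (P x \<and> \<not> Q x))"
    by (intro assms decidable_not decidable_conj)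
  then show ?thesis by simp
qed

lemma decidable_less [comp_intros]:
  assumes "total_computable A f" "total_computable A g"
  shows "decidable A (\<lambda>x. f x < g x)"
proof -
  have "(f x < g x) = (1 - (g x - f x) = 0)" for x
    by auto
  then show ?thesis
    by (simp only:) (intro decidable_eq_0 assms comp_intros)
qed

lemma decidable_eq [comp_intros]:
  assumes "total_computable A f" "total_computable A g"
  shows "decidable A (\<lambda>x. f x = g x)"
proof -
  have "(f x = g x) = ((f x - g x) + (g x - f x) = 0)" for x
    by auto
  then show ?thesis
    by (simp only:) (intro decidable_eq_0 assms comp_intros)
qed

lemma decidable_all_less [comp_intros]:
  assumes "total_computable A n" "decidable A (\<lambda>z. P (pfst z) (psnd z))"
  shows "decidable A (\<lambda>x. \<forall>i<n x. P x i)"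
proof -
  have "(\<forall>i<n x. P x i) = ((\<Sum>i<n x. if P x i then 0 else 1) = (0::nat))" for x
    by auto
  then show ?thesis
    using assms unfolding decidable_def[of A "\<lambda>z. P (pfst z) (psnd z)"]
    by (simp only:) (intro decidable_eq_0 total_computable_sum)
qed

lemma decidable_ex_less [comp_intros]:
  assumes "total_computable A n" "decidable A (\<lambda>z. P (pfst z) (psnd z))"
  shows "decidable A (\<lambda>x. \<exists>i<n x. P x i)"
proof -
  have "decidable A (\<lambda>x. \<not> (\<forall>i<n x. \<not> P x i))"
    by (intro assms decidable_not decidable_all_less)
  then show ?thesis by simp
qed

section \<open>Unbounded search\<close>

lemma decidable_Mu:
  assumes "decidable A (\<lambda>z. P (pfst z) (psnd z))"
  shows "\<exists>p. \<forall>x. run A p x = (if \<exists>n. P x n then Some (LEAST n. P x n) else None)"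
proof -
  obtain p where p: "\<And>z. run A p z = Some (if P (pfst z) (psnd z) then 0 else 1)"
    using assms unfolding decidable_def total_computable_iff by blast
  show ?thesis
    by (rule exI[of _ "Mu p"]) (simp add: p)
qed

lemma total_computable_Least:
  assumes "decidable A (\<lambda>z. P (pfst z) (psnd z))" "\<And>x. \<exists>n. P x n"
  shows "total_computable A (\<lambda>x. LEAST n. P x n)"
  using decidable_Mu[OF assms(1)] assms(2) by (simp add: total_computable_iff)

text \<open>The search has to succeed only from the states \<open>h n\<close> that are actually
  reached; from other states the recursion step may diverge.\<close>

lemma total_computable_iterate_Least:
  assumes Q: "decidable A (\<lambda>z. Q (pfst z) (pfst (psnd z)) (psnd (psnd z)))"
    and ex: "\<And>n. \<exists>t. Q n (h n) t"
    and h: "\<And>n. h (Suc n) = (LEAST t. Q n (h n) t)"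
  shows "total_computable A h"
proof -
  \<comment> \<open>The step of \<open>PrimRec\<close> receives \<open>(a, (n, v))\<close>; the
    parameter \<open>a\<close> is a dummy, set to 0 below.\<close>
  let ?R = "\<lambda>w t. Q (pfst (psnd w)) (psnd (psnd w)) t"
  have "decidable A (\<lambda>z. ?R (pfst z) (psnd z))"
    using decidable_comp[OF Q, of "\<lambda>z. prod_encode (pfst (psnd (pfst z)),
        prod_encode (psnd (psnd (pfst z)), psnd z))"]
    by (simp add: comp_intros)
  then obtain q where q:
    "\<And>x. run A q x = (if \<exists>n. ?R x n then Some (LEAST n. ?R x n) else None)"
    using decidable_Mu[of A ?R] by blast
  obtain p where p: "\<And>x. run A p x = Some (h 0)"
    using total_computable_const unfolding total_computable_iff by blast
  have "run A (PrimRec p q) (prod_encode (0, n)) = Some (h n)" for n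
    by (rule run_PrimRec_total) (auto simp: p q ex h)
  then show ?thesis
    by (intro total_computableI[where p = "Comp (PrimRec p q) (Tuple Zero (Tuple Proj1 Proj2))"]) auto
qed

subsection \<open>Decidable predicates of coded lists\<close>

text \<open>\<open>list_encode\<close> sends the empty list to 0 and \<open>x # xs\<close> to the
  successor of a pair, so subtracting 1 exposes head and tail.\<close>

definition code_hd :: "nat \<Rightarrow> nat" where "code_hd l = pfst (l - 1)"
definition code_drop :: "nat \<Rightarrow> nat \<Rightarrow> nat" where
  "code_drop i l = rec_nat l (\<lambda>_ v. psnd (v - 1)) i"

text \<open>As 0 - 1 is 0, this makes the tail of the empty list empty again:
  \<open>code_drop\<close> stays at 0 past the end.\<close>

lemma prod_decode_0: "prod_decode 0 = (0, 0)"
proof -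
  have "prod_encode (0, 0) = 0"
    by (simp add: prod_encode_def)
  then show ?thesis
    by (metis prod_encode_inverse)
qed

lemma code_drop_list_encode: "code_drop i (list_encode xs) = list_encode (drop i xs)"
proof (induction i)
  case (Suc i)
  have "psnd (list_encode ys - 1) = list_encode (tl ys)" for ys
    by (cases ys) (auto simp: prod_decode_0)
  with Suc show ?case
    by (simp add: code_drop_def drop_Suc tl_drop)
qed (simp add: code_drop_def)

lemma code_hd_list_encode: "xs \<noteq> [] \<Longrightarrow> code_hd (list_encode xs) = hd xs"
  by (cases xs) (auto simp: code_hd_def)

lemma list_encode_eq_0_iff: "list_encode xs = 0 \<longleftrightarrow> xs = []"
  by (cases xs) auto

text \<open>The code serves as a bound on positions, so quantifiers over positions become bounded
  ones without computing the length.\<close>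

lemma length_le_list_encode: "length xs \<le> list_encode xs"
proof (induction xs)
  case (Cons x xs)
  then show ?case
    using le_prod_encode_2[of "list_encode xs" x] by simp
qed simp

lemma total_computable_code_hd [comp_intros]:
  "total_computable A f \<Longrightarrow> total_computable A (\<lambda>x. code_hd (f x))"
  unfolding code_hd_def by (intro comp_intros)

lemma total_computable_code_drop [comp_intros]:
  "total_computable A f \<Longrightarrow> total_computable A g \<Longrightarrow> total_computable A (\<lambda>x. code_drop (f x) (g x))"
  unfolding code_drop_def by (intro total_computable_rec_nat comp_intros)

text \<open>A position is valid exactly if dropping up to it leaves a nonzero code. Handing the rest
  of the list to \<open>P\<close> covers membership, distinctness and adjacency alike.\<close>

lemma decidable_list_all_suffixes:
  assumes "total_computable A l"
    and "decidable A (\<lambda>z. P (pfst z) (pfst (psnd z)) (psnd (psnd z)))"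
  shows "decidable A (\<lambda>x. \<forall>i<length (list_decode (l x)).
           P x (list_decode (l x) ! i) (list_encode (drop (Suc i) (list_decode (l x)))))"
proof -
  have "(\<forall>i<length xs. P x (xs ! i) (list_encode (drop (Suc i) xs))) \<longleftrightarrow>
      (\<forall>i<list_encode xs. code_drop i (list_encode xs) \<noteq> 0 \<longrightarrow>
         P x (code_hd (code_drop i (list_encode xs))) (code_drop (Suc i) (list_encode xs)))" for x xs
    using length_le_list_encode[of xs]
    by (auto simp: code_drop_list_encode code_hd_list_encode list_encode_eq_0_iff hd_drop_conv_nth)
  from this[where xs = "list_decode (l x)" and x = x for x]
  have eq: "(\<forall>i<length (list_decode (l x)).
           P x (list_decode (l x) ! i) (list_encode (drop (Suc i) (list_decode (l x))))) \<longleftrightarrow>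
      (\<forall>i<l x. code_drop i (l x) \<noteq> 0 \<longrightarrow>
         P x (code_hd (code_drop i (l x))) (code_drop (Suc i) (l x)))" for x
    by simp
  have "decidable A (\<lambda>z. P (pfst z) (code_hd (code_drop (psnd z) (l (pfst z))))
            (code_drop (Suc (psnd z)) (l (pfst z))))"
    using decidable_comp[OF assms(2), of "\<lambda>z. prod_encode (pfst z,
        prod_encode (code_hd (code_drop (psnd z) (l (pfst z))), code_drop (Suc (psnd z)) (l (pfst z))))"]
    by (simp add: comp_intros total_computable_comp[OF assms(1)])
  then show ?thesis
    unfolding eq by (intro comp_intros assms total_computable_comp[OF assms(1)])
qed

lemma decidable_mem [comp_intros]:
  assumes "total_computable A f" "total_computable A l"
  shows "decidable A (\<lambda>x. f x \<in> set (list_decode (l x)))"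
proof -
  have "decidable A (\<lambda>x. \<forall>i<length (list_decode (l x)). list_decode (l x) ! i \<noteq> f x)"
    by (rule decidable_list_all_suffixes[OF assms(2), of "\<lambda>x y r. y \<noteq> f x"])
      (intro comp_intros total_computable_comp[OF assms(1)])
  from decidable_not[OF this] show ?thesis
    by (simp add: in_set_conv_nth)
qed

lemma decidable_disjoint [comp_intros]:
  assumes "total_computable A k" "total_computable A l"
  shows "decidable A (\<lambda>x. set (list_decode (k x)) \<inter> set (list_decode (l x)) = {})"
proof -
  have "set xs \<inter> set ys = {} \<longleftrightarrow> (\<forall>i<length xs. xs ! i \<notin> set ys)" for xs ys :: "nat list"
    by (auto simp: in_set_conv_nth disjoint_iff)
  moreover have "decidable A (\<lambda>x. \<forall>i<length (list_decode (k x)).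
      list_decode (k x) ! i \<notin> set (list_decode (l x)))"
    by (rule decidable_list_all_suffixes[OF assms(1), of "\<lambda>x y r. y \<notin> set (list_decode (l x))"])
      (intro comp_intros total_computable_comp[OF assms(2)])
  ultimately show ?thesis
    by simp
qed

lemma decidable_distinct [comp_intros]:
  assumes "total_computable A l"
  shows "decidable A (\<lambda>x. distinct (list_decode (l x)))"
proof -
  have "distinct xs \<longleftrightarrow> (\<forall>i<length xs. xs ! i \<notin> set (drop (Suc i) xs))" for xs :: "nat list"
  proof (induction xs)
    case (Cons x xs)
    then show ?case
      by (simp add: All_less_Suc2)
  qed simp
  moreover have "decidable A (\<lambda>x. \<forall>i<length (list_decode (l x)).
      list_decode (l x) ! i \<notin> set (list_decode (list_encode (drop (Suc i) (list_decode (l x))))))"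
    by (rule decidable_list_all_suffixes[OF assms, of "\<lambda>x y r. y \<notin> set (list_decode r)"])
      (intro comp_intros)
  ultimately show ?thesis
    by simp
qed

lemma decidable_successively:
  assumes "total_computable A l" "decidable A (\<lambda>z. R (pfst z) (psnd z))"
  shows "decidable A (\<lambda>x. successively R (list_decode (l x)))"
proof -
  \<comment> \<open>The next entry is the head of the remainder; remainder code 0 singles out the
    last position, which has no successor.\<close>
  have "successively R xs \<longleftrightarrow> (\<forall>i<length xs. list_encode (drop (Suc i) xs) \<noteq> 0 \<longrightarrow>
      R (xs ! i) (code_hd (list_encode (drop (Suc i) xs))))" for xs
    by (auto simp: successively_conv_nth code_hd_list_encode hd_drop_conv_nth list_encode_eq_0_iff)
  moreover have "decidable A (\<lambda>z. R (pfst (psnd z)) (code_hd (psnd (psnd z))))"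
    using decidable_comp[OF assms(2),
        of "\<lambda>z. prod_encode (pfst (psnd z), code_hd (psnd (psnd z)))"]
    by (simp add: comp_intros)
  then have "decidable A (\<lambda>x. \<forall>i<length (list_decode (l x)).
      list_encode (drop (Suc i) (list_decode (l x))) \<noteq> 0 \<longrightarrow>
      R (list_decode (l x) ! i) (code_hd (list_encode (drop (Suc i) (list_decode (l x))))))"
    by (intro decidable_list_all_suffixes[OF assms(1), of "\<lambda>x y r. r \<noteq> 0 \<longrightarrow> R y (code_hd r)"]
        comp_intros)
  ultimately show ?thesis
    by simp
qed

lemma decidable_suffix [comp_intros]:
  assumes "total_computable A k" "total_computable A l"
  shows "decidable A (\<lambda>x. suffix (list_decode (k x)) (list_decode (l x)))"
proof -
  \<comment> \<open>A suffix is what some \<open>drop\<close> leaves. The bound includes the code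
    itself because the code can equal the length, as for the empty list.\<close>
  have "suffix xs ys \<longleftrightarrow> (\<exists>i<Suc (list_encode ys). code_drop i (list_encode ys) = list_encode xs)"
    for xs ys
  proof
    assume "suffix xs ys"
    then obtain zs where "ys = zs @ xs"
      by (auto simp: suffix_def)
    then show "\<exists>i<Suc (list_encode ys). code_drop i (list_encode ys) = list_encode xs"
      using length_le_list_encode[of ys]
      by (intro exI[of _ "length zs"]) (simp add: code_drop_list_encode)
  qed (auto simp: code_drop_list_encode list_encode_eq intro: suffix_drop)
  from this[where xs = "list_decode (k x)" and ys = "list_decode (l x)" for x]
  have eq: "suffix (list_decode (k x)) (list_decode (l x)) \<longleftrightarrow>
      (\<exists>i<Suc (l x). code_drop i (l x) = k x)" for x
    by simp
  show ?thesis
    unfolding eq by (intro comp_intros assms total_computable_comp[OF assms(1)]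
        total_computable_comp[OF assms(2)])
qed

subsection \<open>Extending disjoint monochromatic paths\<close>

definition edge :: "(nat set \<Rightarrow> color) \<Rightarrow> color \<Rightarrow> nat \<Rightarrow> nat \<Rightarrow> bool" where
  "edge c k a b \<longleftrightarrow> a \<noteq> b \<and> c {a, b} = k"

fun other :: "color \<Rightarrow> color" where
  "other BLUE = RED"
| "other RED = BLUE"

lemma edge_sym: "edge c k a b \<longleftrightarrow> edge c k b a"
  by (auto simp: edge_def insert_commute)

lemma not_edge_other: "a \<noteq> b \<Longrightarrow> \<not> edge c (other k) a b \<Longrightarrow> edge c k a b"
  by (cases k; cases "c {a, b}") (auto simp: edge_def)

lemma edge_BLUE_or_RED: "a \<noteq> b \<Longrightarrow> edge c BLUE a b \<or> edge c RED a b"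
  by (cases "c {a, b}") (auto simp: edge_def)

text \<open>The threshold \<open>m\<close> is a parameter: for given \<open>m\<close> this is a
  universal statement about the coloring, within reach of the jump, while existence of a threshold
  adds a quantifier.\<close>

definition edges_above :: "(nat set \<Rightarrow> color) \<Rightarrow> color \<Rightarrow> nat \<Rightarrow> nat \<Rightarrow> bool" where
  "edges_above c k v m \<longleftrightarrow> (\<forall>y>m. y \<noteq> v \<longrightarrow> edge c k v y)"

definition limit_colored :: "(nat set \<Rightarrow> color) \<Rightarrow> color \<Rightarrow> nat set" where
  "limit_colored c k = {v. \<exists>m. edges_above c k v m}"

lemma edges_above_mono: "edges_above c k v m \<Longrightarrow> m \<le> n \<Longrightarrow> edges_above c k v n"
  by (auto simp: edges_above_def)

lemma finite_fresh:
  fixes F :: "nat set"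
  assumes "finite F"
  obtains y where "y \<notin> F" "m < y"
proof -
  obtain y where "y \<notin> F \<union> {..m}"
    using ex_new_if_finite[OF infinite_UNIV_nat, of "F \<union> {..m}"] assms by auto
  then show ?thesis
    using that[of y] by auto
qed

text \<open>An edge to a vertex beyond both thresholds would have two colors.\<close>

lemma limit_colored_disjoint: "limit_colored c k \<inter> limit_colored c (other k) = {}"
proof (rule ccontr)
  assume "limit_colored c k \<inter> limit_colored c (other k) \<noteq> {}"
  then obtain v m n where "edges_above c k v m" "edges_above c (other k) v n"
    by (auto simp: limit_colored_def)
  moreover obtain y where "y \<notin> {v}" "max m n < y"
    using finite_fresh[of "{v}" "max m n"] by blast
  ultimately have "edge c k v y" "edge c (other k) v y"
    by (auto simp: edges_above_def)
  then show False by (cases k) (auto simp: edge_def)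
qed

lemma fresh_neighbour:
  assumes "v \<notin> limit_colored c (other k)" "finite F"
  obtains y where "y \<notin> F" "m < y" "edge c k v y"
proof -
  have "\<not> edges_above c (other k) v (Max (insert m F))"
    using assms(1) by (auto simp: limit_colored_def)
  then obtain y where "Max (insert m F) < y" "y \<noteq> v" "edge c k v y"
    unfolding edges_above_def using not_edge_other by metis
  with assms(2) that show ?thesis
    by (auto)
qed

text \<open>Far enough out, \<open>u\<close> is joined in color \<open>k\<close> to everything, so
  any neighbour of \<open>x\<close> taken there serves both.\<close>

lemma common_neighbour:
  assumes "u \<in> limit_colored c k" "x \<notin> limit_colored c (other k)" "finite F"
  obtains y where "y \<notin> F" "edge c k u y" "edge c k x y"
proof -
  obtain m where m: "edges_above c k u m"
    using assms(1) by (auto simp: limit_colored_def)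
  obtain y where "y \<notin> insert u F" "m < y" "edge c k x y"
    using fresh_neighbour[OF assms(2), of "insert u F" m] assms(3) by auto
  with m that show ?thesis
    by (auto simp: edges_above_def)
qed

text \<open>The path continues from its end through \<open>y\<close>, \<open>x\<close>,
  \<open>z\<close>, \<open>u\<close>: \<open>y\<close> links the end to \<open>x\<close>, and
  \<open>z\<close> links \<open>x\<close> to a new limit colored vertex \<open>u\<close>, so that
  the step can be repeated.\<close>

lemma absorb:
  assumes inf: "infinite (limit_colored c k)" and F: "finite F"
    and X: "distinct X" "successively (edge c k) X" "X \<noteq> []" "hd X \<in> limit_colored c k"
      "set X \<inter> F = {}"
    and x: "x \<notin> set X" "x \<notin> F" "x \<notin> limit_colored c (other k)"
  obtains Y where "suffix X Y" "distinct Y" "successively (edge c k) Y" "hd Y \<in> limit_colored c k"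
    "set Y \<inter> F = {}" "x \<in> set Y"
proof -
  obtain y where y: "y \<notin> insert x (F \<union> set X)" "edge c k (hd X) y" "edge c k x y"
    using common_neighbour[OF X(4) x(3), of "insert x (F \<union> set X)"] F by auto
  obtain u where u: "u \<in> limit_colored c k" "u \<notin> insert x (insert y (F \<union> set X))"
    using inf F by (metis finite.insertI finite_Un finite_set rev_finite_subset subsetI)
  obtain z where z: "z \<notin> insert u (insert x (insert y (F \<union> set X)))" "edge c k u z" "edge c k x z"
    using common_neighbour[OF u(1) x(3), of "insert u (insert x (insert y (F \<union> set X)))"] F by auto
  show ?thesis
  proof (rule that[of "u # z # x # y # X"])
    show "suffix X (u # z # x # y # X)"
      by (simp add: suffix_ConsI)
    show "successively (edge c k) (u # z # x # y # X)"
      using X y z by (cases X) (auto simp: edge_sym)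
  qed (use X y u z x in auto)
qed

text \<open>The vertices of \<open>G\<close> are added one at a time, each over a common neighbour
  with the current end; this exists because the end is itself limit colored.\<close>

lemma cover:
  assumes "finite G" "G \<subseteq> limit_colored c k" "finite F" "G \<inter> F = {}"
  obtains X where "distinct X" "successively (edge c k) X" "G \<subseteq> set X" "set X \<inter> F = {}"
    "X \<noteq> [] \<longrightarrow> hd X \<in> limit_colored c k"
proof -
  have "\<exists>X. distinct X \<and> successively (edge c k) X \<and> G \<subseteq> set X \<and> set X \<inter> F = {} \<and>
      (X \<noteq> [] \<longrightarrow> hd X \<in> limit_colored c k)"
    using assms
  proof (induction G)
    case empty
    show ?case by (rule exI[of _ "[]"]) auto
  next
    case (insert g G)
    then obtain X where X: "distinct X" "successively (edge c k) X" "G \<subseteq> set X" "set X \<inter> F = {}"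
      "X \<noteq> [] \<longrightarrow> hd X \<in> limit_colored c k"
      by auto
    \<comment> \<open>A vertex of \<open>G\<close> may already have served as a link.\<close>
    consider "g \<in> set X" | "X = []" | "X \<noteq> []" "g \<notin> set X" by auto
    then show ?case
    proof cases
      case 1
      then show ?thesis using X by auto
    next
      case 2
      then show ?thesis using X insert.prems by (intro exI[of _ "[g]"]) auto
    next
      case 3
      have g: "g \<notin> limit_colored c (other k)"
        using insert.prems limit_colored_disjoint by blast
      obtain y where "y \<notin> insert g (F \<union> set X)" "edge c k (hd X) y" "edge c k g y"
        using common_neighbour[of "hd X" c k g "insert g (F \<union> set X)"] X(5) 3 g insert.prems by auto
      then show ?thesis
        using X insert.prems 3 by (intro exI[of _ "g # y # X"]) (cases X, auto simp: edge_sym)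
    qed
  qed
  with that show ?thesis by blast
qed

text \<open>One more fresh vertex on top moves the end out of \<open>H\<close> and makes the path
  nonempty even if \<open>G\<close> is empty.\<close>

lemma cover_end:
  assumes "finite G" "G \<subseteq> limit_colored c k" "finite F" "G \<inter> F = {}" "finite H"
  obtains X where "distinct X" "successively (edge c k) X" "G \<subseteq> set X" "set X \<inter> F = {}"
    "X \<noteq> []" "hd X \<notin> H"
proof -
  obtain X where X: "distinct X" "successively (edge c k) X" "G \<subseteq> set X" "set X \<inter> F = {}"
    "X \<noteq> [] \<longrightarrow> hd X \<in> limit_colored c k"
    using cover assms by metis
  define S where "S = F \<union> H \<union> set X"
  have S: "finite S" using assms by (auto simp: S_def)
  have "\<exists>y. y \<notin> S \<and> (X \<noteq> [] \<longrightarrow> edge c k (hd X) y)"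
  proof (cases "X = []")
    case True
    then show ?thesis using finite_fresh[OF S] by metis
  next
    case False
    then have "hd X \<notin> limit_colored c (other k)"
      using X(5) limit_colored_disjoint by blast
    then show ?thesis using fresh_neighbour S by metis
  qed
  then obtain y where "y \<notin> S" "X \<noteq> [] \<longrightarrow> edge c k (hd X) y" by blast
  then show ?thesis
    using X by (intro that[of "y # X"]) (auto simp: S_def successively_Cons edge_sym)
qed

section \<open>States of the construction and their invariant\<close>

text \<open>Paths under construction are stored in reverse order: \<open>hd\<close> is the end that gets extended.\<close>

definition disjoint_paths :: "(nat set \<Rightarrow> color) \<Rightarrow> (color \<Rightarrow> nat list) \<Rightarrow> bool" where
  "disjoint_paths c P \<longleftrightarrow> (\<forall>k. distinct (P k) \<and> successively (edge c k) (P k)) \<and>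
     set (P BLUE) \<inter> set (P RED) = {}"

definition extends :: "(color \<Rightarrow> nat list) \<Rightarrow> (color \<Rightarrow> nat list) \<Rightarrow> bool" where
  "extends P P' \<longleftrightarrow> (\<forall>k. suffix (P k) (P' k))"

definition vertices :: "(color \<Rightarrow> nat list) \<Rightarrow> nat set" where
  "vertices P = set (P BLUE) \<union> set (P RED)"

text \<open>A single threshold serves both colors, so that a search can guess it as one
  number.\<close>

definition good_end :: "(nat set \<Rightarrow> color) \<Rightarrow> (color \<Rightarrow> nat list) \<Rightarrow> nat \<Rightarrow> bool" where
  "good_end c P m \<longleftrightarrow> (\<forall>k. infinite (limit_colored c k) \<longrightarrow> edges_above c k (hd (P k)) m)"

text \<open>Using up a finite class ensures that no new vertex belongs to it. By the last clause,
  both ends have neighbours of either color arbitrarily far out.\<close>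

definition invariant :: "(nat set \<Rightarrow> color) \<Rightarrow> (color \<Rightarrow> nat list) \<Rightarrow> bool" where
  "invariant c P \<longleftrightarrow> disjoint_paths c P \<and> (\<exists>m. good_end c P m) \<and>
     (\<forall>k. P k \<noteq> [] \<and> (finite (limit_colored c k) \<longrightarrow> limit_colored c k \<subseteq> vertices P)) \<and>
     (finite (limit_colored c BLUE \<union> limit_colored c RED) \<longrightarrow>
       (\<forall>k. hd (P k) \<notin> limit_colored c BLUE \<union> limit_colored c RED))"

lemma all_color: "(\<forall>k. Q k) \<longleftrightarrow> Q BLUE \<and> Q RED"
  by (auto, rename_tac k, case_tac k, auto)

lemma ex_good_end_iff:
  "(\<exists>m. good_end c P m) \<longleftrightarrow>
     (\<forall>k. infinite (limit_colored c k) \<longrightarrow> hd (P k) \<in> limit_colored c k)"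
proof
  assume *: "\<forall>k. infinite (limit_colored c k) \<longrightarrow> hd (P k) \<in> limit_colored c k"
  then have "\<forall>k. \<exists>m. infinite (limit_colored c k) \<longrightarrow> edges_above c k (hd (P k)) m"
    unfolding limit_colored_def by blast
  from choice[OF this] obtain m where
    m: "infinite (limit_colored c k) \<Longrightarrow> edges_above c k (hd (P k)) (m k)" for k
    by blast
  have "good_end c P (max (m BLUE) (m RED))"
    unfolding good_end_def
  proof (intro allI impI)
    fix k
    assume "infinite (limit_colored c k)"
    from m[OF this] show "edges_above c k (hd (P k)) (max (m BLUE) (m RED))"
      by (rule edges_above_mono) (cases k; simp)
  qed
  then show "\<exists>m. good_end c P m" ..
qed (auto simp: good_end_def limit_colored_def)

lemma extends_vertices: "extends P P' \<Longrightarrow> vertices P \<subseteq> vertices P'"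
  unfolding extends_def vertices_def by (meson Un_mono set_mono_suffix)

text \<open>The clauses on finite classes persist: covered vertices stay covered, and a new end lies
  outside \<open>vertices P\<close>, which contains all limit colored vertices when both classes are
  finite.\<close>

lemma invariant_extends:
  assumes I: "invariant c P" and d: "disjoint_paths c P'" and e: "extends P P'"
    and g: "good_end c P' m"
  shows "invariant c P'"
proof -
  have ne: "P' k \<noteq> []" for k
    using I e unfolding invariant_def extends_def by (metis suffix_bot.extremum_uniqueI)
  moreover have "hd (P' k) \<notin> limit_colored c BLUE \<union> limit_colored c RED"
    if fin: "finite (limit_colored c BLUE \<union> limit_colored c RED)" for k
  proof -
    obtain ys where ys: "P' k = ys @ P k"
      using e by (auto simp: extends_def suffix_def)
    show ?thesis
    proof (cases ys)
      case Nil
      then show ?thesis using I fin ys unfolding invariant_def by simp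
    next
      case (Cons y zs)
      have "distinct (P' k)"
        using d by (simp add: disjoint_paths_def)
      then have "y \<notin> set (P k)"
        using ys Cons by simp
      moreover have "y \<notin> set (P (other k))"
      proof -
        have "set (P (other k)) \<subseteq> set (P' (other k))"
          using e unfolding extends_def by (simp add: set_mono_suffix)
        moreover have "y \<in> set (P' k)" using ys Cons by simp
        ultimately show ?thesis
          using d unfolding disjoint_paths_def by (cases k) auto
      qed
      ultimately have "y \<notin> vertices P"
        unfolding vertices_def by (cases k) auto
      then show ?thesis
        using I fin ys Cons unfolding invariant_def by (simp add: all_color) blast
    qed
  qed
  ultimately show ?thesis
    using I d g extends_vertices[OF e] unfolding invariant_def by blast
qed

lemma invariant_exists: "\<exists>P. invariant c P"
proof -
  let ?L = "limit_colored c"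
  \<comment> \<open>The path of color \<open>k\<close> takes in the finite class; the other path
    starts as a single vertex of the infinite class.\<close>
  have mixed: "\<exists>P. invariant c P" if k: "finite (?L k)" "infinite (?L (other k))" for k
  proof -
    obtain X where X: "distinct X" "successively (edge c k) X" "?L k \<subseteq> set X" "X \<noteq> []"
      using cover_end[OF k(1) subset_refl, of "{}" "{}"] by auto
    obtain u where "u \<in> ?L (other k)" "u \<notin> set X"
      using k(2) by (metis List.finite_set rev_finite_subset subsetI)
    with X k show ?thesis
      unfolding invariant_def ex_good_end_iff
      by (cases k; intro exI[of _ "\<lambda>j. if j = k then X else [u]"])
        (auto simp: all_color disjoint_paths_def vertices_def)
  qed
  consider "finite (?L BLUE)" "finite (?L RED)" | "finite (?L BLUE)" "infinite (?L RED)"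
    | "infinite (?L BLUE)" "finite (?L RED)" | "infinite (?L BLUE)" "infinite (?L RED)"
    by blast
  then show ?thesis
  proof cases
    case 1
    have disj: "?L BLUE \<inter> ?L RED = {}"
      using limit_colored_disjoint[of c BLUE] by simp
    \<comment> \<open>The blue path avoids the red class, leaving it free for the red path, which is
      built second and around the first.\<close>
    obtain X where X: "distinct X" "successively (edge c BLUE) X" "?L BLUE \<subseteq> set X"
      "set X \<inter> ?L RED = {}" "X \<noteq> []" "hd X \<notin> ?L BLUE \<union> ?L RED"
      using cover_end[of "?L BLUE" c BLUE "?L RED" "?L BLUE \<union> ?L RED"] 1 disj by auto
    obtain Y where Y: "distinct Y" "successively (edge c RED) Y" "?L RED \<subseteq> set Y"
      "set Y \<inter> set X = {}" "Y \<noteq> []" "hd Y \<notin> ?L BLUE \<union> ?L RED"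
      using cover_end[of "?L RED" c RED "set X" "?L BLUE \<union> ?L RED"] 1 X(4) by auto
    show ?thesis
      using 1 X Y unfolding invariant_def ex_good_end_iff
      by (intro exI[of _ "\<lambda>k. if k = BLUE then X else Y"])
        (auto simp: all_color disjoint_paths_def vertices_def)
  next
    case 2
    then show ?thesis using mixed[of BLUE] by simp
  next
    case 3
    then show ?thesis using mixed[of RED] by simp
  next
    case 4
    then obtain b r where "b \<in> ?L BLUE" "r \<in> ?L RED"
      by (metis finite.emptyI equals0I)
    moreover from this have "b \<noteq> r"
      using limit_colored_disjoint[of c BLUE] by auto
    ultimately show ?thesis
      using 4 unfolding invariant_def ex_good_end_iff
      by (intro exI[of _ "\<lambda>k. if k = BLUE then [b] else [r]"])
        (auto simp: all_color disjoint_paths_def vertices_def)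
  qed
qed

lemma absorb_finite_case:
  assumes I: "invariant c P" and fin: "finite (limit_colored c BLUE \<union> limit_colored c RED)"
    and x: "x \<notin> vertices P"
  obtains k ys where "distinct (ys @ P k)" "successively (edge c k) (ys @ P k)"
    "set ys \<inter> vertices P = {}" "x \<in> set ys"
proof -
  note result = that
  define b r where "b = hd (P BLUE)" and "r = hd (P RED)"
  obtain B R where P: "P BLUE = b # B" "P RED = r # R"
    using I unfolding invariant_def b_def r_def by (metis list.collapse)
  have F: "finite (insert x (vertices P))" by (simp add: vertices_def)
  have "b \<notin> limit_colored c (other BLUE)" "r \<notin> limit_colored c (other RED)"
    using I fin unfolding invariant_def b_def r_def by auto
  then obtain y z where y: "y \<notin> insert x (vertices P)" "edge c BLUE b y"
    and z: "z \<notin> insert x (vertices P)" "edge c RED r z"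
    using fresh_neighbour[OF _ F] by metis
  have D: "disjoint_paths c P" using I by (simp add: invariant_def)
  \<comment> \<open>\<open>blue\<close> and \<open>red\<close> reduce the case analysis to naming a
    list through \<open>x\<close>, and possibly \<open>y\<close> and \<open>z\<close>, that can be
    put in front of the old end.\<close>
  have blue: thesis if "distinct ys" "successively (edge c BLUE) (ys @ [b])" "x \<in> set ys"
    "set ys \<subseteq> {x, y, z}" for ys
    using that x y z D
    by (intro result[of ys BLUE]) (auto simp: P vertices_def disjoint_paths_def all_color successively_append_iff)
  have red: thesis if "distinct ys" "successively (edge c RED) (ys @ [r])" "x \<in> set ys"
    "set ys \<subseteq> {x, y, z}" for ys
    using that x y z D
    by (intro result[of ys RED]) (auto simp: P vertices_def disjoint_paths_def all_color successively_append_iff)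
  have xb: "x \<noteq> b" "x \<noteq> r" "x \<noteq> y" "x \<noteq> z"
    using x y z P by (auto simp: vertices_def)
  consider "edge c BLUE x b" | "edge c RED x r" | "edge c BLUE x y" | "edge c RED x z"
    | "edge c RED x y" "edge c BLUE x z"
    using xb edge_BLUE_or_RED by metis
  then show thesis
  proof cases
    case 1 then show ?thesis by (intro blue[of "[x]"]) auto
  next
    case 2 then show ?thesis by (intro red[of "[x]"]) auto
  next
    case 3 then show ?thesis using y xb by (intro blue[of "[x, y]"]) (auto simp: edge_sym)
  next
    case 4 then show ?thesis using z xb by (intro red[of "[x, z]"]) (auto simp: edge_sym)
  next
    case 5
    \<comment> \<open>\<open>y\<close> and \<open>z\<close> were chosen independently and could
      coincide, but here their edges to \<open>x\<close> differ in color.\<close>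
    then have "y \<noteq> z" by (auto simp: edge_def)
    then consider "edge c BLUE y z" | "edge c RED y z" using edge_BLUE_or_RED by metis
    then show ?thesis
    proof cases
      case 1
      then show ?thesis using 5 \<open>y \<noteq> z\<close> y xb by (intro blue[of "[x, z, y]"]) (auto simp: edge_sym)
    next
      case 2
      then show ?thesis using 5 \<open>y \<noteq> z\<close> z xb by (intro red[of "[x, y, z]"]) (auto simp: edge_sym)
    qed
  qed
qed

text \<open>At most one path changes, which \<open>upd\<close> handles. The conclusion states what a
  search can test; \<open>invariant_extends\<close> recovers the invariant from it.\<close>

lemma invariant_step:
  assumes I: "invariant c P"
  shows "\<exists>P' m. disjoint_paths c P' \<and> extends P P' \<and> x \<in> vertices P' \<and> good_end c P' m"
proof -
  let ?L = "limit_colored c"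
  have D: "disjoint_paths c P" and ne: "\<And>k. P k \<noteq> []"
    and G: "\<And>k. infinite (?L k) \<Longrightarrow> hd (P k) \<in> ?L k"
    using I unfolding invariant_def ex_good_end_iff by auto
  have vert: "vertices P = set (P k) \<union> set (P (other k))" for k
    by (cases k) (auto simp: vertices_def)
  have upd: ?thesis if "suffix (P k) Y" "distinct Y" "successively (edge c k) Y"
    "set Y \<inter> set (P (other k)) = {}" "x \<in> set Y" "infinite (?L k) \<Longrightarrow> hd Y \<in> ?L k" for k Y
  proof -
    let ?P = "P(k := Y)"
    have "disjoint_paths c ?P" "extends P ?P" "x \<in> vertices ?P"
      using that D by (cases k; auto simp: disjoint_paths_def all_color extends_def vertices_def)+
    moreover have "\<exists>m. good_end c ?P m"
      unfolding ex_good_end_iff using that G by auto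
    ultimately show ?thesis by blast
  qed
  show ?thesis
  proof (cases "x \<in> vertices P")
    case True
    have "extends P P" by (simp add: extends_def)
    moreover obtain m where "good_end c P m" using I unfolding invariant_def by auto
    ultimately show ?thesis using True D by blast
  next
    case x: False
    show ?thesis
    proof (cases "finite (?L BLUE \<union> ?L RED)")
      case True
      obtain k ys where "distinct (ys @ P k)" "successively (edge c k) (ys @ P k)"
        "set ys \<inter> vertices P = {}" "x \<in> set ys"
        by (rule_tac absorb_finite_case[OF I True x]) blast
      moreover have "set (P k) \<inter> set (P (other k)) = {}"
        using D by (cases k) (auto simp: disjoint_paths_def)
      moreover have "finite (?L k)" using True by (cases k) auto
      ultimately show ?thesis
        by (intro upd[of k "ys @ P k"]) (auto simp: suffix_def vert[of k])
    next
      case False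
      have "?L BLUE \<inter> ?L RED = {}" using limit_colored_disjoint[of c BLUE] by simp
      then have disj: "y \<in> ?L (other j) \<Longrightarrow> y \<notin> ?L j" for y j
        by (cases j) auto
      obtain j where j: "infinite (?L j)"
        using False by blast
      have "\<exists>k. infinite (?L k) \<and> x \<notin> ?L (other k)"
      proof (cases "x \<in> ?L (other j)")
        case True
        then have "infinite (?L (other j))"
          using x I unfolding invariant_def by blast
        moreover have "x \<notin> ?L (other (other j))"
          using disj[OF True] by (cases j) auto
        ultimately show ?thesis by blast
      qed (use j in blast)
      then obtain k where k: "infinite (?L k)" "x \<notin> ?L (other k)" by blast
      obtain Y where "suffix (P k) Y" "distinct Y" "successively (edge c k) Y" "hd Y \<in> ?L k"
        "set Y \<inter> set (P (other k)) = {}" "x \<in> set Y"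
      proof (rule absorb[OF k(1), of "set (P (other k))" "P k" x])
        show "set (P k) \<inter> set (P (other k)) = {}"
          using D by (cases k) (auto simp: disjoint_paths_def)
        show "distinct (P k)" "successively (edge c k) (P k)"
          using D by (auto simp: disjoint_paths_def)
        show "x \<notin> set (P k)" "x \<notin> set (P (other k))" using x vert by auto
      qed (use k ne G in auto)
      then show ?thesis by (intro upd) auto
    qed
  qed
qed

subsection \<open>The limit of a growing sequence of paths\<close>

text \<open>Reversal makes position \<open>i\<close> count from the fixed beginning of the path. The
  least stage is what an unbounded search returns.\<close>

definition limit_path :: "(nat \<Rightarrow> nat list) \<Rightarrow> nat \<rightharpoonup> nat" where
  "limit_path X i = (if \<exists>n. i < length (X n)
     then Some (rev (X (LEAST n. i < length (X n))) ! i) else None)"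

context
  fixes X :: "nat \<Rightarrow> nat list"
  assumes suffix_step: "\<And>n. suffix (X n) (X (Suc n))"
begin

lemma suffix_chain: "m \<le> n \<Longrightarrow> suffix (X m) (X n)"
  by (induction n rule: dec_induct) (auto intro: suffix_step suffix_order.trans)

text \<open>Growth happens at the head, so reversed lists only gain entries at their far
  end.\<close>

lemma limit_path_eq:
  assumes "i < length (X n)"
  shows "limit_path X i = Some (rev (X n) ! i)"
proof -
  define m where "m = (LEAST n. i < length (X n))"
  have m: "i < length (X m)" "m \<le> n"
    unfolding m_def using assms by (auto intro: LeastI Least_le)
  from suffix_chain[OF m(2)] obtain ys where "X n = ys @ X m"
    by (auto simp: suffix_def)
  then have "rev (X n) ! i = rev (X m) ! i"
    using m(1) by (simp add: nth_append)
  then show ?thesis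
    using assms unfolding limit_path_def m_def by auto
qed

lemma limit_path_SomeE:
  assumes "limit_path X i = Some a"
  obtains n where "i < length (X n)" "a = rev (X n) ! i"
proof -
  obtain n where n: "i < length (X n)"
    using assms by (auto simp: limit_path_def split: if_splits)
  with limit_path_eq[OF n] assms show ?thesis
    by (intro that[of n]) auto
qed

lemma dom_limit_path: "i \<in> dom (limit_path X) \<longleftrightarrow> (\<exists>n. i < length (X n))"
  by (auto simp: limit_path_def split: if_splits)

lemma ran_limit_path: "ran (limit_path X) = (\<Union>n. set (X n))"
proof (intro set_eqI iffI)
  fix a
  assume "a \<in> ran (limit_path X)"
  then obtain i n where "i < length (X n)" "a = rev (X n) ! i"
    by (auto simp: ran_def elim: limit_path_SomeE)
  then show "a \<in> (\<Union>n. set (X n))"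
    by (metis UN_I UNIV_I length_rev nth_mem set_rev)
next
  fix a
  assume "a \<in> (\<Union>n. set (X n))"
  then obtain n where "a \<in> set (rev (X n))"
    by auto
  then obtain i where "i < length (X n)" "rev (X n) ! i = a"
    by (metis in_set_conv_nth length_rev)
  then show "a \<in> ran (limit_path X)"
    using limit_path_eq by (auto intro: ranI)
qed

lemma mono_path_limit_path:
  assumes d: "\<And>n. distinct (X n)" and s: "\<And>n. successively (edge c k) (X n)"
  shows "mono_path c k (limit_path X)"
  unfolding mono_path_def
proof (intro conjI allI impI)
  show "initial_segment (dom (limit_path X))"
    unfolding initial_segment_def
  proof (intro ballI allI impI)
    fix i j
    assume "j \<in> dom (limit_path X)" "i < j"
    then show "i \<in> dom (limit_path X)"
      unfolding dom_limit_path by (meson less_trans)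
  qed
  show "inj_on (limit_path X) (dom (limit_path X))"
  proof (rule inj_onI)
    fix i j
    assume "i \<in> dom (limit_path X)" "j \<in> dom (limit_path X)" and eq: "limit_path X i = limit_path X j"
    then obtain m n where mn: "i < length (X m)" "j < length (X n)"
      unfolding dom_limit_path by blast
    define l where "l = max m n"
    have "length (X m) \<le> length (X l)" "length (X n) \<le> length (X l)"
      unfolding l_def by (intro suffix_length_le suffix_chain; simp)+
    with mn have l: "i < length (X l)" "j < length (X l)"
      by linarith+
    with eq have "rev (X l) ! i = rev (X l) ! j"
      using limit_path_eq[of i l] limit_path_eq[of j l] by simp
    then show "i = j"
      using l d[of l] by (simp add: nth_eq_iff_index_eq)
  qed
  fix i a b
  assume a: "limit_path X i = Some a" and "limit_path X (Suc i) = Some b"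
  then obtain n where n: "Suc i < length (X n)" "b = rev (X n) ! Suc i"
    by (blast elim: limit_path_SomeE)
  then have "a = rev (X n) ! i"
    using a limit_path_eq[of i n] by simp
  moreover have "successively (edge c k) (rev (X n))"
    using s[of n] by (simp add: edge_sym[of c k])
  ultimately show "c {a, b} = k"
    using n by (auto simp: successively_conv_nth edge_def)
qed

lemma partial_computable_limit_path:
  assumes "total_computable A (\<lambda>n. list_encode (X n))"
  shows "partial_computable_in A (limit_path X)"
proof -
  note X = total_computable_comp[OF assms]
  have code: "code_drop i (list_encode xs) = 0 \<longleftrightarrow> length xs \<le> i" for i xs
    by (simp add: code_drop_list_encode list_encode_eq_0_iff)
  have "decidable A (\<lambda>z. \<not> code_drop (pfst z) (list_encode (X (psnd z))) = 0)"
    by (intro X comp_intros)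
  then obtain p where p: "run A p i =
      (if \<exists>n. i < length (X n) then Some (LEAST n. i < length (X n)) else None)" for i
    using decidable_Mu[of A "\<lambda>i n. i < length (X n)"] by (auto simp: code not_le)
  \<comment> \<open>Entry \<open>i\<close> of the path is stored at \<open>length - Suc i\<close>,
    found as the least \<open>j\<close> such that dropping \<open>Suc (j + i)\<close> entries leaves
    nothing. This search ends on every input.\<close>
  let ?last = "\<lambda>z. LEAST j. code_drop (Suc (j + pfst z)) (list_encode (X (psnd z))) = 0"
  have "total_computable A ?last"
  proof (rule total_computable_Least)
    show "\<exists>j. code_drop (Suc (j + pfst z)) (list_encode (X (psnd z))) = 0" for z
      unfolding code by (intro exI[of _ "length (X (psnd z))"]) simp
  qed (intro X comp_intros)
  then have "total_computable A (\<lambda>z. code_hd (code_drop (?last z) (list_encode (X (psnd z)))))"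
    by (intro X comp_intros)
  then obtain q where
    q: "run A q z = Some (code_hd (code_drop (?last z) (list_encode (X (psnd z)))))" for z
    unfolding total_computable_iff by blast
  have entry: "run A q (prod_encode (i, n)) = Some (rev (X n) ! i)" if i: "i < length (X n)" for i n
  proof -
    have "(LEAST j. code_drop (Suc (j + i)) (list_encode (X n)) = 0) = length (X n) - Suc i"
      unfolding code using i by (intro Least_equality) auto
    moreover have "drop (length (X n) - Suc i) (X n) \<noteq> []"
      using i by simp
    ultimately show ?thesis
      using i by (simp add: q code_drop_list_encode code_hd_list_encode hd_drop_conv_nth rev_nth)
  qed
  \<comment> \<open>\<open>p\<close> diverges at positions that no stage reaches, so the composition
    is undefined exactly off the domain.\<close>
  have "run A (Comp q (Tuple (Tuple Proj1 Proj2) p)) i = limit_path X i" for i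
  proof (cases "\<exists>n. i < length (X n)")
    case True
    then have "i < length (X (LEAST n. i < length (X n)))"
      by (rule LeastI_ex)
    then show ?thesis
      using True by (simp add: p limit_path_def entry)
  next
    case False
    then show ?thesis
      by (simp add: p limit_path_def)
  qed
  then show ?thesis
    unfolding partial_computable_in_def by blast
qed

end

subsection \<open>Deciding halting problems\<close>

text \<open>The property of the oracle set on which the construction rests. The jump has it, and for
  a computable coloring so does the halting set; one argument thus yields both claims.\<close>

definition decides_domains :: "nat set \<Rightarrow> (nat \<Rightarrow> nat) \<Rightarrow> bool" where
  "decides_domains S A \<longleftrightarrow> (\<forall>p. decidable (char_fun S) (\<lambda>x. run A p x \<noteq> None))"

primrec const_prog :: "nat \<Rightarrow> prog" where
  "const_prog 0 = Zero"
| "const_prog (Suc n) = Comp Succ (const_prog n)"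

lemma run_const_prog: "run A (const_prog n) x = Some n"
  by (induction n) auto

lemma total_computable_code_const_prog: "total_computable A (\<lambda>x. code (const_prog x))"
proof -
  \<comment> \<open>Four copies of \<open>e\<close> make up the factor 4 in \<open>code\<close>; 6
    is the offset of \<open>Comp\<close>, and 1 is the code of \<open>Succ\<close>.\<close>
  have "code (const_prog x) = rec_nat 0 (\<lambda>_ v. let e = prod_encode (1, v) in 6 + (e + e + (e + e))) x"
    for x by (induction x) (auto simp: Let_def)
  moreover have "total_computable A
      (\<lambda>x. rec_nat 0 (\<lambda>_ v. let e = prod_encode (1, v) in 6 + (e + e + (e + e))) x)"
    unfolding Let_def by (intro total_computable_rec_nat comp_intros)
  ultimately show ?thesis by simp
qed

text \<open>The jump concerns programs run on their own code. \<open>Comp p (const_prog x)\<close>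
  acts on every input like \<open>p\<close> on \<open>x\<close>, and its code is computable from
  \<open>x\<close>.\<close>

lemma jump_decides_domains: "decides_domains (jump A) A"
  unfolding decides_domains_def
proof
  fix p
  let ?e = "\<lambda>x. prod_encode (code p, code (const_prog x))"
  let ?f = "\<lambda>x. 6 + (?e x + ?e x + (?e x + ?e x))"
  have f: "code (Comp p (const_prog x)) = ?f x" for x
    by simp
  have "run A p x \<noteq> None \<longleftrightarrow> run A (Comp p (const_prog x)) y \<noteq> None" for x y
    by (simp add: run_const_prog)
  then have "run A p x \<noteq> None \<longleftrightarrow> code (Comp p (const_prog x)) \<in> jump A" for x
    unfolding jump_def mem_Collect_eq code_inject by (metis (no_types))
  then have "run A p x \<noteq> None \<longleftrightarrow> char_fun (jump A) (?f x) = 1" for x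
    unfolding f by (simp add: char_fun_def)
  moreover have "decidable (char_fun (jump A)) (\<lambda>x. char_fun (jump A) (?f x) = 1)"
    by (intro comp_intros total_computable_oracle total_computable_code_const_prog)
  ultimately show "decidable (char_fun (jump A)) (\<lambda>x. run A p x \<noteq> None)"
    by (simp only:)
qed

primrec subst_query :: "prog \<Rightarrow> prog \<Rightarrow> prog" where
  "subst_query r Zero = Zero"
| "subst_query r Succ = Succ"
| "subst_query r Proj1 = Proj1"
| "subst_query r Proj2 = Proj2"
| "subst_query r Query = r"
| "subst_query r (Tuple p q) = Tuple (subst_query r p) (subst_query r q)"
| "subst_query r (Comp p q) = Comp (subst_query r p) (subst_query r q)"
| "subst_query r (PrimRec p q) = PrimRec (subst_query r p) (subst_query r q)"
| "subst_query r (Mu p) = Mu (subst_query r p)"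

lemma run_subst_query:
  assumes "run B r = (\<lambda>x. Some (A x))"
  shows "run B (subst_query r p) = run A p"
  by (induction p) (simp_all add: assms)

text \<open>Replacing each query by a program for \<open>A\<close> turns programs relative to
  \<open>A\<close> into equivalent ones relative to \<open>no_oracle\<close>.\<close>

lemma halting_set_decides_domains:
  assumes "computable A"
  shows "decides_domains halting_set A"
proof -
  obtain r where "run no_oracle r = (\<lambda>x. Some (A x))"
    using assms unfolding computable_def partial_computable_in_def by blast
  then have "run A p = run no_oracle (subst_query r p)" for p
    using run_subst_query by metis
  then show ?thesis
    using jump_decides_domains[of no_oracle] unfolding decides_domains_def halting_set_def by simp
qed

text \<open>The search for a witness halts exactly if there is one.\<close>

lemma decidable_ex:
  assumes "decides_domains S A" "decidable A (\<lambda>z. P (pfst z) (psnd z))"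
  shows "decidable (char_fun S) (\<lambda>x. \<exists>n. P x n)"
proof -
  obtain p where "\<forall>x. run A p x = (if \<exists>n. P x n then Some (LEAST n. P x n) else None)"
    using decidable_Mu[OF assms(2)] by blast
  then have "run A p x \<noteq> None \<longleftrightarrow> (\<exists>n. P x n)" for x
    by simp
  moreover have "decidable (char_fun S) (\<lambda>x. run A p x \<noteq> None)"
    using assms(1) unfolding decides_domains_def by blast
  ultimately show ?thesis by (simp only:)
qed

text \<open>The oracle \<open>B\<close> is left open: it is the coloring below an unbounded
  quantifier and \<open>S\<close> elsewhere.\<close>

lemma decidable_edge:
  assumes "decidable B (\<lambda>x. color_fun c x = 0)" "total_computable B f" "total_computable B g"
  shows "decidable B (\<lambda>x. edge c k (f x) (g x))"
proof (cases k)
  case BLUE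
  \<comment> \<open>\<open>color_fun\<close> is also 0 on the diagonal, so blue needs an explicit
    test that the endpoints differ.\<close>
  have "edge c BLUE a b \<longleftrightarrow> \<not> a = b \<and> color_fun c (prod_encode (a, b)) = 0" for a b
    by (cases "c {a, b}") (auto simp: edge_def color_fun_def)
  then show ?thesis
    unfolding BLUE by (simp only:) (intro comp_intros assms decidable_comp[OF assms(1)])
next
  case RED
  have "edge c RED a b \<longleftrightarrow> \<not> color_fun c (prod_encode (a, b)) = 0" for a b
    by (auto simp: edge_def color_fun_def)
  then show ?thesis
    unfolding RED by (simp only:) (intro comp_intros assms decidable_comp[OF assms(1)])
qed

subsection \<open>The computation of a decomposition\<close>

context
  fixes c :: "nat set \<Rightarrow> color" and S :: "nat set"
  assumes S: "decides_domains S (color_fun c)"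
begin

lemma color_fun_decidable_self: "decidable (color_fun c) (\<lambda>x. color_fun c x = 0)"
  by (intro comp_intros total_computable_oracle)

text \<open>A vacuous quantifier shows that \<open>S\<close> decides the coloring itself.\<close>

lemma color_fun_decidable: "decidable (char_fun S) (\<lambda>x. color_fun c x = 0)"
  using decidable_ex[OF S, of "\<lambda>x n. color_fun c x = 0"]
    decidable_comp[OF color_fun_decidable_self total_computable_pfst[OF total_computable_id]]
  by simp

text \<open>The negation asks for one exceptional edge, an existential statement over a predicate
  decidable in the coloring.\<close>

lemma decidable_edges_above:
  assumes "total_computable (char_fun S) f" "total_computable (char_fun S) m"
  shows "decidable (char_fun S) (\<lambda>x. edges_above c k (f x) (m x))"
proof -
  let ?R = "\<lambda>w y. psnd w < y \<and> \<not> y = pfst w \<and> \<not> edge c k (pfst w) y"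
  have "decidable (char_fun S) (\<lambda>w. \<exists>y. ?R w y)"
    by (rule decidable_ex[OF S]) (intro comp_intros decidable_edge color_fun_decidable_self)
  from decidable_not[OF decidable_comp[OF this total_computable_pair[OF assms]]]
  have "decidable (char_fun S) (\<lambda>x. \<not> (\<exists>y. ?R (prod_encode (f x, m x)) y))" .
  moreover have "edges_above c k (f x) (m x) \<longleftrightarrow> \<not> (\<exists>y. ?R (prod_encode (f x, m x)) y)" for x
    by (auto simp: edges_above_def)
  ultimately show ?thesis by (simp only:)
qed

text \<open>A state of the search is coded as \<open>(m, (blue path, red path))\<close>, where \<open>m\<close> witnesses \<^const>\<open>good_end\<close>.\<close>

definition component :: "color \<Rightarrow> nat \<Rightarrow> nat" where
  "component k t = (if k = BLUE then pfst (psnd t) else psnd (psnd t))"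

definition paths :: "nat \<Rightarrow> color \<Rightarrow> nat list" where
  "paths t k = list_decode (component k t)"

lemma paths_surj: "\<exists>t. pfst t = m \<and> paths t = P"
proof -
  have "paths (prod_encode (m, prod_encode (list_encode (P BLUE), list_encode (P RED)))) k = P k" for k
    by (cases k) (auto simp: paths_def component_def)
  then show ?thesis
    by (intro exI[of _ "prod_encode (m, prod_encode (list_encode (P BLUE), list_encode (P RED)))"]) auto
qed

lemma total_computable_component:
  "total_computable A f \<Longrightarrow> total_computable A (\<lambda>x. component k (f x))"
  by (cases k) (simp_all add: component_def comp_intros)

text \<open>Phrased with codes so that the closure rules apply; nonzero components ensure that
  \<open>code_hd\<close> gives the end of the path.\<close>

definition stage :: "nat \<Rightarrow> nat \<Rightarrow> nat \<Rightarrow> bool" where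
  "stage n s t \<longleftrightarrow> disjoint_paths c (paths t) \<and> extends (paths s) (paths t) \<and>
     n \<in> vertices (paths t) \<and> (\<forall>k. component k t \<noteq> 0) \<and>
     (\<forall>k. infinite (limit_colored c k) \<longrightarrow> edges_above c k (code_hd (component k t)) (pfst t))"

lemma stage_iff: "stage n s t \<longleftrightarrow> disjoint_paths c (paths t) \<and> extends (paths s) (paths t) \<and>
     n \<in> vertices (paths t) \<and> (\<forall>k. paths t k \<noteq> []) \<and> good_end c (paths t) (pfst t)"
proof -
  have ne: "component k t \<noteq> 0 \<longleftrightarrow> paths t k \<noteq> []" for k
    using list_encode_eq_0_iff[of "paths t k"] by (simp add: paths_def)
  have "paths t k \<noteq> [] \<Longrightarrow> code_hd (component k t) = hd (paths t k)" for k
    using code_hd_list_encode[of "paths t k"] by (simp add: paths_def)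
  then show ?thesis
    unfolding stage_def good_end_def ne by auto
qed

text \<open>Whether a class is infinite is a fixed truth value for each of the two colors and enters
  as a constant, so the program is not obtained uniformly in \<open>c\<close>.\<close>

lemma decidable_stage:
  "decidable (char_fun S) (\<lambda>z. stage (pfst z) (pfst (psnd z)) (psnd (psnd z)))"
proof -
  have edges: "decidable (char_fun S) (\<lambda>x. successively (edge c k) (list_decode (l x)))"
    if "total_computable (char_fun S) l" for k l
    by (intro decidable_successively decidable_edge color_fun_decidable comp_intros that)
  show ?thesis
    unfolding stage_def disjoint_paths_def extends_def vertices_def all_color paths_def Un_iff
    by (intro comp_intros edges decidable_edges_above total_computable_component)
qed

lemma decomposition_exists:
  "\<exists>P. path_decomposition c P \<and> decomposition_computable_from S P"
proof -
  obtain P0 m0 where "invariant c P0"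
    using invariant_exists by blast
  \<comment> \<open>The starting state is one number, so it may be fixed without a way to compute
    it.\<close>
  then obtain t0 where t0: "invariant c (paths t0)"
    using paths_surj[of 0 P0] by auto
  \<comment> \<open>Step \<open>n\<close> searches for a state whose paths contain the vertex
    \<open>n\<close>; thus every number is reached.\<close>
  define h where "h = rec_nat t0 (\<lambda>n s. LEAST t. stage n s t)"
  have ex: "\<exists>t. stage n s t" if I: "invariant c (paths s)" for n s
  proof -
    obtain P' m where P': "disjoint_paths c P'" "extends (paths s) P'" "n \<in> vertices P'"
      "good_end c P' m"
      using invariant_step[OF I] by blast
    moreover have "P' k \<noteq> []" for k
      using I P'(2) unfolding invariant_def extends_def
      by (metis suffix_bot.extremum_uniqueI)
    ultimately show ?thesis
      using paths_surj[of m P'] unfolding stage_iff by auto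
  qed
  have least: "stage n (h n) (h (Suc n))" if "invariant c (paths (h n))" for n
    using LeastI_ex[OF ex[OF that]] by (simp add: h_def)
  \<comment> \<open>The invariant at \<open>n\<close> makes the search succeed, and its success
    gives the invariant at \<open>Suc n\<close>.\<close>
  have I: "invariant c (paths (h n))" for n
  proof (induction n)
    case 0
    show ?case by (simp add: h_def t0)
  next
    case (Suc n)
    from least[OF Suc] invariant_extends[OF Suc] show ?case
      unfolding stage_iff by blast
  qed
  define X where "X k n = paths (h n) k" for k n
  have stage: "stage n (h n) (h (Suc n))" for n
    by (rule least[OF I])
  have X: "suffix (X k n) (X k (Suc n))" for k n
    using stage[of n] unfolding stage_iff extends_def X_def by blast
  have D: "disjoint_paths c (paths (h n))" for n
    using I[of n] by (simp add: invariant_def)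
  have h: "total_computable (char_fun S) h"
    by (rule total_computable_iterate_Least[OF decidable_stage])
      (auto simp: ex[OF I], simp add: h_def)
  have comp: "partial_computable_in (char_fun S) (limit_path (X k))" for k
  proof (rule partial_computable_limit_path[of "X k", OF X])
    show "total_computable (char_fun S) (\<lambda>n. list_encode (X k n))"
      using total_computable_component[OF h, of k] by (simp add: X_def paths_def)
  qed
  have mono: "mono_path c k (limit_path (X k))" for k
    using D by (intro mono_path_limit_path X) (auto simp: X_def disjoint_paths_def)
  have cover: "n \<in> ran (limit_path (X BLUE)) \<or> n \<in> ran (limit_path (X RED))" for n
    using stage[of n] unfolding stage_iff vertices_def ran_limit_path[of "X _", OF X] X_def by blast
  have disj: "\<not> (n \<in> ran (limit_path (X BLUE)) \<and> n \<in> ran (limit_path (X RED)))" for n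
  proof
    assume "n \<in> ran (limit_path (X BLUE)) \<and> n \<in> ran (limit_path (X RED))"
    then obtain i j where "n \<in> set (X BLUE i)" "n \<in> set (X RED j)"
      unfolding ran_limit_path[of "X _", OF X] by blast
    then have "n \<in> set (X BLUE (max i j))" "n \<in> set (X RED (max i j))"
      using set_mono_suffix[OF suffix_chain[of "X BLUE", OF X]]
        set_mono_suffix[OF suffix_chain[of "X RED", OF X]]
      by (meson max.cobounded1 max.cobounded2 subsetD)+
    then show False
      using D[of "max i j"] unfolding disjoint_paths_def X_def by blast
  qed
  have "path_decomposition c (limit_path (X BLUE), limit_path (X RED))"
    unfolding path_decomposition_def using mono cover disj by auto
  moreover have "decomposition_computable_from S (limit_path (X BLUE), limit_path (X RED))"
    unfolding decomposition_computable_from_def using comp by simp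
  ultimately show ?thesis by blast
qed

end

theorem theorem4:
  fixes c :: "nat set \<Rightarrow> color"
  shows "(\<exists>P. path_decomposition c P \<and>
              decomposition_computable_from (jump (color_fun c)) P) \<and>
         (computable (color_fun c) \<longrightarrow>
            (\<exists>P. path_decomposition c P \<and> decomposition_computable_from halting_set P))"
  using decomposition_exists jump_decides_domains halting_set_decides_domains by blast

end
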